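(* Let $\{\mathfrak V_i\}_{i=1}^n$ be a finite family of full bundles of $\Omega$-spaces over the same base space $X$, $\mathfrak V_i=\langle\langle\mathfrak E_i,\tau_i\rangle,\pi_i,X,\mathfrak N_i\rangle$, and let $\bigoplus_{i=1}^n\mathfrak V_i$ be their bundle direct sum, with total space $\mathfrak E(\mathsf E^\oplus)$ and projection $\pi_{\mathsf E^\oplus}$. Let $f:X\to\mathfrak E(\mathsf E^\oplus)$, $x\in X$, and let $f_0:X\to\bigcup_{z\in X}\mathsf E_z^\oplus$ be such that $f(z)=(z,f_0(z))$ for all $z\in X$; put $f_0^i(z)=\Pr_i^{\pi_{\mathsf E^\oplus}(f(z))}(f_0(z))$ for $i=1,\dots,n$. Then $f$ is continuous at $x$ if and only if $f_0^i:X\to\mathfrak E_i$ is continuous at $x$ for all $i=1,\dots,n$. In particular $f\in\Gamma(\pi_{\mathsf E^\oplus})$ if and only if $\bigl(X\ni z\mapsto\Pr_i^z(f_0(z))\in(\mathfrak E_i)_z\bigr)\in\Gamma(\pi_i)$ for all $i=1,\dots,n$.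
   Context: Vector spaces are over $\mathbb K\in\{\mathbb R,\mathbb C\}$. Bundles. A bundle of $\Omega$-spaces $\langle\langle\mathfrak E,\tau\rangle,\pi,X,\mathfrak N\rangle$ (Gierz) consists of topological spaces $\langle\mathfrak E,\tau\rangle$ and $X$, a continuous open surjection $\pi:\mathfrak E\to X$, a vector space structure on each stalk $\mathfrak E_x=\pi^{-1}(x)$ such that addition $\{(a,b):\pi(a)=\pi(b)\}\to\mathfrak E$ and scalar multiplication are continuous, and a set $\mathfrak N=\{\nu_j:j\in J\}$ of functions $\mathfrak E\to[0,\infty[$ whose restrictions to each $\mathfrak E_x$ form a directed family of seminorms generating the (Hausdorff) topology induced by $\tau$ on $\mathfrak E_x$. For $U\subseteq X$, $\Gamma_U(\pi)$ is the set of continuous $\sigma:U\to\mathfrak E$ with $\sigma(x)\in\mathfrak E_x$ and $\sup_{x\in U}\nu_j(\sigma(x))<\infty$ for all $j$; $\Gamma(\pi)=\Gamma_X(\pi)$. The tubes $\{\beta:\pi(\beta)\in U,\nu_j(\beta-\sigma(\pi(\beta)))<\varepsilon\}$ ($U$ open, $\sigma\in\Gamma_U(\pi)$, $\varepsilon>0$, $j\in J$) form a base of $\tau$. The bundle is full if each $\alpha\in\mathfrak E$ equals $\sigma(\pi(\alpha))$ for some $\sigma\in\Gamma(\pi)$. Direct sum. Let $\mathfrak N_i=\{\nu_{i,l_i}:l_i\in L_i\}$ and $\nu^x_{i,l_i}$ the restriction to $(\mathfrak E_i)_x$. Put $\mathsf E_x^\oplus=\bigoplus_{i=1}^n(\mathfrak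 E_i)_x$ with projections $\Pr_i^x$ and inclusions $I_i^x$, $\hat\mu_\rho^x=\sum_{i=1}^n\nu^x_{i,\rho_i}\circ\Pr_i^x$ for $\rho\in\prod_iL_i$, and let $\mathcal E^\oplus$ be the linear span in $\prod_x\mathsf E_x^\oplus$ of the sections $x\mapsto I_i^x(g(x))$, $1\le i\le n$, $g\in\Gamma(\pi_i)$. The bundle direct sum $\bigoplus_i\mathfrak V_i$ is the bundle of $\Omega$-spaces with total space $\mathfrak E(\mathsf E^\oplus)=\bigcup_{x\in X}\{x\}\times\mathsf E_x^\oplus$, projection $\pi_{\mathsf E^\oplus}(x,v)=x$, seminorms $\hat\mu_\rho(x,v)=\hat\mu_\rho^x(v)$, and the topology in which the neighbourhood filter of $(x,v)$ has as base the sets $\{(y,w):y\in U,\ \hat\mu_\rho^y(w-\sigma(y))<\varepsilon\}$ with $U\ni x$ open, $\sigma\in\mathcal E^\oplus$, $\varepsilon>0$, $\rho\in\prod_iL_i$ and $\hat\mu^x_\rho(v-\sigma(x))<\varepsilon$. *)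

theory Defs
  imports "HOL-Analysis.Analysis" "HOL-Algebra.Module"
begin

text \<open>
  The scalar field is a set \<open>K\<close> of complex numbers, either \<open>\<real>\<close> or \<open>UNIV\<close>.
  A vector space over \<open>K\<close> with an explicit carrier is a module over the ring
  \<open>scalars K\<close>; the fields \<open>mult\<close> and \<open>one\<close> of a module record carry no meaning.
\<close>

definition scalars :: "complex set \<Rightarrow> complex ring" where
  "scalars K = \<lparr>carrier = K, monoid.mult = (*), one = 1, zero = 0, add = (+)\<rparr>"

abbreviation vector_space_over :: "complex set \<Rightarrow> (complex, 'v) module \<Rightarrow> bool" where
  "vector_space_over K M \<equiv> Module.module (scalars K) M"

definition product_module :: "'i set \<Rightarrow> ('i \<Rightarrow> ('k, 'v) module) \<Rightarrow> ('k, 'i \<Rightarrow> 'v) module" where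
  "product_module I M =
    \<lparr>carrier = (\<Pi>\<^sub>E i\<in>I. carrier (M i)),
     monoid.mult = undefined,
     one = undefined,
     zero = (\<lambda>i\<in>I. \<zero>\<^bsub>M i\<^esub>),
     add = (\<lambda>v w. \<lambda>i\<in>I. v i \<oplus>\<^bsub>M i\<^esub> w i),
     smult = (\<lambda>c v. \<lambda>i\<in>I. c \<odot>\<^bsub>M i\<^esub> v i)\<rparr>"

definition linear_span :: "complex set \<Rightarrow> (complex, 'v) module \<Rightarrow> 'v set \<Rightarrow> 'v set" where
  "linear_span K M S = (\<lambda>H. submodule H (scalars K) M) hull S"

definition is_seminorm :: "complex set \<Rightarrow> (complex, 'v) module \<Rightarrow> ('v \<Rightarrow> real) \<Rightarrow> bool" where
  "is_seminorm K M p \<longleftrightarrow>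
     (\<forall>v\<in>carrier M. 0 \<le> p v) \<and>
     (\<forall>v\<in>carrier M. \<forall>w\<in>carrier M. p (v \<oplus>\<^bsub>M\<^esub> w) \<le> p v + p w) \<and>
     (\<forall>c\<in>K. \<forall>v\<in>carrier M. p (c \<odot>\<^bsub>M\<^esub> v) = cmod c * p v)"

definition directed_seminorms :: "(complex, 'v) module \<Rightarrow> 'j set \<Rightarrow> ('j \<Rightarrow> 'v \<Rightarrow> real) \<Rightarrow> bool" where
  "directed_seminorms M J p \<longleftrightarrow>
     J \<noteq> {} \<and>
     (\<forall>j\<in>J. \<forall>k\<in>J. \<exists>l\<in>J. \<forall>v\<in>carrier M. p j v \<le> p l v \<and> p k v \<le> p l v)"

definition seminorm_topology :: "(complex, 'v) module \<Rightarrow> 'j set \<Rightarrow> ('j \<Rightarrow> 'v \<Rightarrow> real) \<Rightarrow> 'v topology" where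
  "seminorm_topology M J p =
     topology_generated_by
       {{w \<in> carrier M. p j (w \<ominus>\<^bsub>M\<^esub> v) < \<epsilon>} | j v \<epsilon>. j \<in> J \<and> v \<in> carrier M \<and> 0 < \<epsilon>}"

text \<open>
  The data of a bundle. The topological spaces are abstract topologies, so that the points of
  the total space and of the base space are those of the respective \<open>topspace\<close>.
\<close>

record ('x, 'e, 'j) omega_bundle =
  total :: "'e topology"
  base :: "'x topology"
  proj :: "'e \<Rightarrow> 'x"
  stalk :: "'x \<Rightarrow> (complex, 'e) module"
  index :: "'j set"
  seminorm :: "'j \<Rightarrow> 'e \<Rightarrow> real"

text \<open>
  Membership in \<open>sections_on B U\<close> only depends on the values of a section on \<open>U\<close>.
\<close>

definition sections_on :: "('x, 'e, 'j) omega_bundle \<Rightarrow> 'x set \<Rightarrow> ('x \<Rightarrow> 'e) set" where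
  "sections_on B U =
     {\<sigma> \<in> (\<Pi> x\<in>U. carrier (stalk B x)).
        continuous_map (subtopology (base B) U) (total B) \<sigma> \<and>
        (\<forall>j\<in>index B. bdd_above ((\<lambda>x. seminorm B j (\<sigma> x)) ` U))}"

abbreviation sections :: "('x, 'e, 'j) omega_bundle \<Rightarrow> ('x \<Rightarrow> 'e) set" where
  "sections B \<equiv> sections_on B (topspace (base B))"

definition tube ::
  "('x, 'e, 'j) omega_bundle \<Rightarrow> 'x set \<Rightarrow> ('x \<Rightarrow> 'e) \<Rightarrow> real \<Rightarrow> 'j \<Rightarrow> 'e set" where
  "tube B U \<sigma> \<epsilon> j =
     {\<beta> \<in> topspace (total B). proj B \<beta> \<in> U \<and>
        seminorm B j (\<beta> \<ominus>\<^bsub>stalk B (proj B \<beta>)\<^esub> \<sigma> (proj B \<beta>)) < \<epsilon>}"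

definition bundle_of_omega_spaces :: "complex set \<Rightarrow> ('x, 'e, 'j) omega_bundle \<Rightarrow> bool" where
  "bundle_of_omega_spaces K B \<longleftrightarrow>
     continuous_map (total B) (base B) (proj B) \<and>
     open_map (total B) (base B) (proj B) \<and>
     proj B ` topspace (total B) = topspace (base B) \<and>
     (\<forall>x\<in>topspace (base B).
        carrier (stalk B x) = {\<alpha> \<in> topspace (total B). proj B \<alpha> = x} \<and>
        vector_space_over K (stalk B x)) \<and>
     continuous_map
       (subtopology (prod_topology (total B) (total B)) {(\<alpha>, \<beta>). proj B \<alpha> = proj B \<beta>})
       (total B)
       (\<lambda>(\<alpha>, \<beta>). \<alpha> \<oplus>\<^bsub>stalk B (proj B \<alpha>)\<^esub> \<beta>) \<and>
     continuous_map
       (prod_topology (top_of_set K) (total B))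
       (total B)
       (\<lambda>(c, \<alpha>). c \<odot>\<^bsub>stalk B (proj B \<alpha>)\<^esub> \<alpha>) \<and>
     (\<forall>x\<in>topspace (base B).
        (\<forall>j\<in>index B. is_seminorm K (stalk B x) (seminorm B j)) \<and>
        directed_seminorms (stalk B x) (index B) (seminorm B) \<and>
        subtopology (total B) (carrier (stalk B x)) =
          seminorm_topology (stalk B x) (index B) (seminorm B) \<and>
        Hausdorff_space (subtopology (total B) (carrier (stalk B x)))) \<and>
     openin (total B) =
       arbitrary union_of
         (\<lambda>T. \<exists>U \<sigma> \<epsilon> j. openin (base B) U \<and> \<sigma> \<in> sections_on B U \<and> 0 < \<epsilon> \<and> j \<in> index B \<and>
                T = tube B U \<sigma> \<epsilon> j)"

definition full_bundle :: "('x, 'e, 'j) omega_bundle \<Rightarrow> bool" where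
  "full_bundle B \<longleftrightarrow>
     (\<forall>\<alpha>\<in>topspace (total B). \<exists>\<sigma>\<in>sections B. \<sigma> (proj B \<alpha>) = \<alpha>)"

definition sum_space ::
  "nat \<Rightarrow> (nat \<Rightarrow> ('x, 'e, 'j) omega_bundle) \<Rightarrow> 'x \<Rightarrow> (complex, nat \<Rightarrow> 'e) module" where
  "sum_space n V x = product_module {1..n} (\<lambda>i. stalk (V i) x)"

definition sum_Pr ::
  "nat \<Rightarrow> (nat \<Rightarrow> ('x, 'e, 'j) omega_bundle) \<Rightarrow> nat \<Rightarrow> 'x \<Rightarrow> (nat \<Rightarrow> 'e) \<Rightarrow> 'e" where
  "sum_Pr n V i x = (\<lambda>v\<in>carrier (sum_space n V x). v i)"

definition sum_In ::
  "nat \<Rightarrow> (nat \<Rightarrow> ('x, 'e, 'j) omega_bundle) \<Rightarrow> nat \<Rightarrow> 'x \<Rightarrow> 'e \<Rightarrow> (nat \<Rightarrow> 'e)" where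
  "sum_In n V i x a = (\<lambda>k\<in>{1..n}. if k = i then a else \<zero>\<^bsub>stalk (V k) x\<^esub>)"

definition sum_index :: "nat \<Rightarrow> (nat \<Rightarrow> ('x, 'e, 'j) omega_bundle) \<Rightarrow> (nat \<Rightarrow> 'j) set" where
  "sum_index n V = (\<Pi>\<^sub>E i\<in>{1..n}. index (V i))"

definition sum_seminorm ::
  "nat \<Rightarrow> (nat \<Rightarrow> ('x, 'e, 'j) omega_bundle) \<Rightarrow> (nat \<Rightarrow> 'j) \<Rightarrow> 'x \<Rightarrow> (nat \<Rightarrow> 'e) \<Rightarrow> real" where
  "sum_seminorm n V \<rho> x v = (\<Sum>i=1..n. seminorm (V i) (\<rho> i) (sum_Pr n V i x v))"

definition sum_sections ::
  "complex set \<Rightarrow> 'x topology \<Rightarrow> nat \<Rightarrow> (nat \<Rightarrow> ('x, 'e, 'j) omega_bundle)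
    \<Rightarrow> ('x \<Rightarrow> nat \<Rightarrow> 'e) set" where
  "sum_sections K X n V =
     linear_span K (product_module (topspace X) (sum_space n V))
       {(\<lambda>x\<in>topspace X. sum_In n V i x (g x)) | i g. i \<in> {1..n} \<and> g \<in> sections (V i)}"

definition sum_tube ::
  "'x topology \<Rightarrow> nat \<Rightarrow> (nat \<Rightarrow> ('x, 'e, 'j) omega_bundle) \<Rightarrow>
    'x set \<Rightarrow> ('x \<Rightarrow> nat \<Rightarrow> 'e) \<Rightarrow> real \<Rightarrow> (nat \<Rightarrow> 'j) \<Rightarrow> ('x \<times> (nat \<Rightarrow> 'e)) set" where
  "sum_tube X n V U \<sigma> \<epsilon> \<rho> =
     {(y, w) \<in> (SIGMA y:topspace X. carrier (sum_space n V y)).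
        y \<in> U \<and> sum_seminorm n V \<rho> y (w \<ominus>\<^bsub>sum_space n V y\<^esub> \<sigma> y) < \<epsilon>}"

text \<open>
  A set is open iff it is a neighbourhood of each of its points, the tubes containing a point
  being its basic neighbourhoods.
\<close>

definition sum_topology ::
  "complex set \<Rightarrow> 'x topology \<Rightarrow> nat \<Rightarrow> (nat \<Rightarrow> ('x, 'e, 'j) omega_bundle)
    \<Rightarrow> ('x \<times> (nat \<Rightarrow> 'e)) topology" where
  "sum_topology K X n V =
     topology (\<lambda>W. W \<subseteq> (SIGMA y:topspace X. carrier (sum_space n V y)) \<and>
       (\<forall>p\<in>W. \<exists>U \<sigma> \<epsilon> \<rho>. openin X U \<and> \<sigma> \<in> sum_sections K X n V \<and> 0 < \<epsilon> \<and> \<rho> \<in> sum_index n V \<and>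
          p \<in> sum_tube X n V U \<sigma> \<epsilon> \<rho> \<and> sum_tube X n V U \<sigma> \<epsilon> \<rho> \<subseteq> W))"

definition sum_stalk ::
  "nat \<Rightarrow> (nat \<Rightarrow> ('x, 'e, 'j) omega_bundle) \<Rightarrow> 'x \<Rightarrow> (complex, 'x \<times> (nat \<Rightarrow> 'e)) module" where
  "sum_stalk n V x =
    \<lparr>carrier = {x} \<times> carrier (sum_space n V x),
     monoid.mult = undefined,
     one = undefined,
     zero = (x, \<zero>\<^bsub>sum_space n V x\<^esub>),
     add = (\<lambda>p q. (x, snd p \<oplus>\<^bsub>sum_space n V x\<^esub> snd q)),
     smult = (\<lambda>c p. (x, c \<odot>\<^bsub>sum_space n V x\<^esub> snd p))\<rparr>"

definition bundle_sum ::
  "complex set \<Rightarrow> 'x topology \<Rightarrow> nat \<Rightarrow> (nat \<Rightarrow> ('x, 'e, 'j) omega_bundle)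
    \<Rightarrow> ('x, 'x \<times> (nat \<Rightarrow> 'e), nat \<Rightarrow> 'j) omega_bundle" where
  "bundle_sum K X n V =
    \<lparr>total = sum_topology K X n V,
     base = X,
     proj = fst,
     stalk = sum_stalk n V,
     index = sum_index n V,
     seminorm = (\<lambda>\<rho> (x, v). sum_seminorm n V \<rho> x v)\<rparr>"

end

theory Submission
  imports Defs
begin

text \<open>
  The topology of the bundle direct sum is the one induced from the product topology on
  \<open>X \<times> \<Prod>\<^sub>i E\<^sub>i\<close>. A tube of the sum contains a product of tubes of the summands around each of its
  points, since the slack in the radius can be distributed over the summands. Conversely, a product
  of tubes around \<open>(x, v)\<close> contains a tube of the sum: by fullness there are global sections through
  the components of \<open>v\<close>, and they may serve as centres of smaller tubes. Only openness of tubes is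
  used here, because the seminorms are directed on each stalk separately and not uniformly near \<open>x\<close>.
  Continuity at a point is then componentwise, and a finite sum of seminorms is bounded along a
  section iff each summand is.
\<close>

section \<open>Modules: the scalar ring, products and submodules\<close>

lemma scalars_simps [simp]:
  "carrier (scalars K) = K" "x \<otimes>\<^bsub>scalars K\<^esub> y = x * y" "\<one>\<^bsub>scalars K\<^esub> = 1"
  "\<zero>\<^bsub>scalars K\<^esub> = 0" "x \<oplus>\<^bsub>scalars K\<^esub> y = x + y"
  by (auto simp: scalars_def)

lemma cring_scalars:
  assumes "K = \<real> \<or> K = UNIV"
  shows "cring (scalars K)"
proof (rule cringI)
  show "abelian_group (scalars K)"
  proof (rule abelian_groupI)
    fix x assume "x \<in> carrier (scalars K)"
    then show "\<exists>y\<in>carrier (scalars K). y \<oplus>\<^bsub>scalars K\<^esub> x = \<zero>\<^bsub>scalars K\<^esub>"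
      using assms by (intro bexI[of _ "- x"]) auto
  qed (use assms in auto)
  show "comm_monoid (scalars K)"
    by (rule comm_monoidI) (use assms in auto)
qed (auto simp: algebra_simps)

lemma product_module_simps [simp]:
  "carrier (product_module I M) = (\<Pi>\<^sub>E i\<in>I. carrier (M i))"
  "\<zero>\<^bsub>product_module I M\<^esub> = (\<lambda>i\<in>I. \<zero>\<^bsub>M i\<^esub>)"
  "v \<oplus>\<^bsub>product_module I M\<^esub> w = (\<lambda>i\<in>I. v i \<oplus>\<^bsub>M i\<^esub> w i)"
  "c \<odot>\<^bsub>product_module I M\<^esub> v = (\<lambda>i\<in>I. c \<odot>\<^bsub>M i\<^esub> v i)"
  by (simp_all add: product_module_def)

text \<open>All laws hold componentwise. The lemma is applied twice: to the finite direct sum of the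
  stalks over a point, and to the product of these sums over all points of the base.\<close>

lemma module_product_module:
  assumes R: "cring R" and M: "\<And>i. i \<in> I \<Longrightarrow> Module.module R (M i)"
  shows "Module.module R (product_module I M)"
proof (rule moduleI)
  have ab: "abelian_group (M i)" if "i \<in> I" for i
    using M[OF that] by (simp add: Module.module_def)
  note abE = abelian_groupE[OF ab]
  show "abelian_group (product_module I M)"
  proof (rule abelian_groupI)
    fix x assume x: "x \<in> carrier (product_module I M)"
    show "\<exists>y\<in>carrier (product_module I M).
        y \<oplus>\<^bsub>product_module I M\<^esub> x = \<zero>\<^bsub>product_module I M\<^esub>"
      using x ab
      by (intro bexI[of _ "\<lambda>i\<in>I. \<ominus>\<^bsub>M i\<^esub> x i"])
        (auto simp: PiE_iff abelian_group.a_inv_closed abelian_group.l_neg)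
  qed (auto simp: PiE_iff extensional_def fun_eq_iff abE(1,2) 
       intro: abE(3,4,5))
qed (use R M in \<open>auto simp: PiE_iff extensional_def fun_eq_iff
       module.smult_l_distr module.smult_assoc1
       intro!: module.smult_closed module.smult_r_distr module.smult_one\<close>)

text \<open>The family of componentwise negatives is a left inverse of \<open>w\<close>, so
  uniqueness of inverses in the additive group identifies it with the negative of
  \<open>w\<close>.\<close>

lemma product_module_minus:
  assumes M: "\<And>i. i \<in> I \<Longrightarrow> abelian_group (M i)"
    and v: "v \<in> carrier (product_module I M)" and w: "w \<in> carrier (product_module I M)"
    and P: "abelian_group (product_module I M)"
  shows "v \<ominus>\<^bsub>product_module I M\<^esub> w = (\<lambda>i\<in>I. v i \<ominus>\<^bsub>M i\<^esub> w i)"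
proof -
  have "\<ominus>\<^bsub>product_module I M\<^esub> w = (\<lambda>i\<in>I. \<ominus>\<^bsub>M i\<^esub> w i)"
    by (rule abelian_group.minus_equality[OF P])
      (use M w in \<open>auto simp: PiE_iff abelian_group.a_inv_closed abelian_group.l_neg\<close>)
  then show ?thesis
    by (auto simp: a_minus_def fun_eq_iff)
qed

lemma (in module) smult_minus_one:
  "x \<in> carrier M \<Longrightarrow> (\<ominus> \<one>) \<odot>\<^bsub>M\<^esub> x = \<ominus>\<^bsub>M\<^esub> x"
  using smult_l_minus[of \<one> x] by simp

text \<open>Closure under negation comes for free, because \<open>-a\<close> is the scalar multiple
  of \<open>a\<close> by \<open>-1\<close>.\<close>

lemma (in module) submodule_if_closed:
  assumes "H \<subseteq> carrier M" "\<zero>\<^bsub>M\<^esub> \<in> H"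
    and "\<And>a b. \<lbrakk>a \<in> H; b \<in> H\<rbrakk> \<Longrightarrow> a \<oplus>\<^bsub>M\<^esub> b \<in> H"
    and smult: "\<And>a x. \<lbrakk>a \<in> carrier R; x \<in> H\<rbrakk> \<Longrightarrow> a \<odot>\<^bsub>M\<^esub> x \<in> H"
  shows "submodule H R M"
proof (rule submoduleI)
  fix a assume "a \<in> H"
  then show "\<ominus>\<^bsub>M\<^esub> a \<in> H"
    using smult[of "\<ominus> \<one>" a] smult_minus_one[of a] assms(1) by auto
qed (use assms in auto)

section \<open>Continuity at a point\<close>

text \<open>Every open set lies in \<open>topspace X\<close>, so values outside it are never seen.
  This allows \<open>f\<close>, which is known only on \<open>topspace X\<close>, to be exchanged
  for an explicit expression.\<close>

lemma topcontinuous_at_eq: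
  assumes h: "topcontinuous_at X Y h x" and eq: "\<And>z. z \<in> topspace X \<Longrightarrow> h z = h' z"
  shows "topcontinuous_at X Y h' x"
  unfolding topcontinuous_at_def
proof (intro conjI allI impI)
  show x: "x \<in> topspace X" using h by (simp add: topcontinuous_at_def)
  show "h' \<in> topspace X \<rightarrow> topspace Y" using h eq by (auto simp: topcontinuous_at_def Pi_iff)
  fix W assume "openin Y W \<and> h' x \<in> W"
  then obtain U where U: "openin X U" "x \<in> U" "\<forall>y\<in>U. h y \<in> W"
    using h eq[OF x] unfolding topcontinuous_at_def by metis
  moreover have "h' y \<in> W" if "y \<in> U" for y
    using U(3) that eq[of y] openin_subset[OF U(1)] by (metis subsetD)
  ultimately show "\<exists>U. openin X U \<and> x \<in> U \<and> (\<forall>y\<in>U. h' y \<in> W)" by blast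
qed

lemma topcontinuous_at_cong:
  assumes "\<And>z. z \<in> topspace X \<Longrightarrow> h z = h' z"
  shows "topcontinuous_at X Y h x \<longleftrightarrow> topcontinuous_at X Y h' x"
  using topcontinuous_at_eq[of X Y h x h'] topcontinuous_at_eq[of X Y h' x h] assms by auto

section \<open>A single bundle: seminorms, tubes and the space of sections\<close>

locale omega_space_bundle =
  fixes K :: "complex set" and B :: "('x, 'e, 'j) omega_bundle"
  assumes K: "K = \<real> \<or> K = UNIV"
    and omega: "bundle_of_omega_spaces K B"
begin

lemma zero_scalar: "0 \<in> K"
  using K by auto

lemma stalk_module: "x \<in> topspace (base B) \<Longrightarrow> vector_space_over K (stalk B x)"
  using omega by (simp add: bundle_of_omega_spaces_def)

lemma stalk_abelian_group: "x \<in> topspace (base B) \<Longrightarrow> abelian_group (stalk B x)"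
  using stalk_module by (simp add: Module.module_def)

lemma carrier_stalk:
  "x \<in> topspace (base B) \<Longrightarrow> carrier (stalk B x) = {\<alpha> \<in> topspace (total B). proj B \<alpha> = x}"
  using omega by (simp add: bundle_of_omega_spaces_def)

lemma stalk_seminorm:
  assumes "x \<in> topspace (base B)" "j \<in> index B"
  shows "is_seminorm K (stalk B x) (seminorm B j)"
  using omega assms by (simp add: bundle_of_omega_spaces_def)

lemma seminorm_nonneg:
  "\<lbrakk>x \<in> topspace (base B); j \<in> index B; v \<in> carrier (stalk B x)\<rbrakk> \<Longrightarrow> 0 \<le> seminorm B j v"
  using stalk_seminorm by (auto simp: is_seminorm_def)

lemma seminorm_add:
  "\<lbrakk>x \<in> topspace (base B); j \<in> index B; v \<in> carrier (stalk B x); w \<in> carrier (stalk B x)\<rbrakk>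
    \<Longrightarrow> seminorm B j (v \<oplus>\<^bsub>stalk B x\<^esub> w) \<le> seminorm B j v + seminorm B j w"
  using stalk_seminorm by (auto simp: is_seminorm_def)

lemma seminorm_smult:
  "\<lbrakk>x \<in> topspace (base B); j \<in> index B; c \<in> K; v \<in> carrier (stalk B x)\<rbrakk>
    \<Longrightarrow> seminorm B j (c \<odot>\<^bsub>stalk B x\<^esub> v) = cmod c * seminorm B j v"
  using stalk_seminorm by (auto simp: is_seminorm_def)

lemma seminorm_zero:
  assumes "x \<in> topspace (base B)" "j \<in> index B"
  shows "seminorm B j \<zero>\<^bsub>stalk B x\<^esub> = 0"
proof -
  interpret module "scalars K" "stalk B x" using assms(1) by (rule stalk_module)
  show ?thesis
    using seminorm_smult[OF assms zero_scalar, of "\<zero>\<^bsub>stalk B x\<^esub>"] smult_r_null[of 0] zero_scalar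
    by simp
qed

text \<open>Subadditivity applied to \<open>u - w = (u - v) + (v - w)\<close>. It serves to move the
  centre of a tube.\<close>

lemma seminorm_triangle:
  assumes x: "x \<in> topspace (base B)" "j \<in> index B"
    and c: "u \<in> carrier (stalk B x)" "v \<in> carrier (stalk B x)" "w \<in> carrier (stalk B x)"
  shows "seminorm B j (u \<ominus>\<^bsub>stalk B x\<^esub> w)
    \<le> seminorm B j (u \<ominus>\<^bsub>stalk B x\<^esub> v) + seminorm B j (v \<ominus>\<^bsub>stalk B x\<^esub> w)"
proof -
  interpret abelian_group "stalk B x" using x(1) by (rule stalk_abelian_group)
  have "u \<ominus>\<^bsub>stalk B x\<^esub> w = (u \<ominus>\<^bsub>stalk B x\<^esub> v) \<oplus>\<^bsub>stalk B x\<^esub> (v \<ominus>\<^bsub>stalk B x\<^esub> w)"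
    using c by (simp add: a_minus_def a_assoc r_neg1)
  then show ?thesis
    using seminorm_add[OF x, of "u \<ominus>\<^bsub>stalk B x\<^esub> v" "v \<ominus>\<^bsub>stalk B x\<^esub> w"] c by simp
qed

text \<open>Nonemptiness is part of directedness, which is demanded stalk by stalk; a point of the
  base is therefore required.\<close>

lemma index_nonempty:
  assumes "x \<in> topspace (base B)"
  shows "index B \<noteq> {}"
proof -
  have "directed_seminorms (stalk B x) (index B) (seminorm B)"
    using omega assms by (simp add: bundle_of_omega_spaces_def)
  then show ?thesis by (simp add: directed_seminorms_def)
qed

lemma tube_base:
  "openin (total B) = arbitrary union_of
     (\<lambda>T. \<exists>U \<sigma> \<epsilon> j. openin (base B) U \<and> \<sigma> \<in> sections_on B U \<and> 0 < \<epsilon> \<and> j \<in> index B \<and>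
            T = tube B U \<sigma> \<epsilon> j)"
  using omega by (simp add: bundle_of_omega_spaces_def)

lemma openin_tube:
  assumes "openin (base B) U" "\<sigma> \<in> sections_on B U" "0 < \<epsilon>" "j \<in> index B"
  shows "openin (total B) (tube B U \<sigma> \<epsilon> j)"
  unfolding tube_base
  by (rule arbitrary_union_of_inc, intro exI conjI) (rule assms refl)+

lemma tube_neighbourhood:
  assumes "openin (total B) W" "\<alpha> \<in> W"
  obtains U \<sigma> \<epsilon> j where "openin (base B) U" "\<sigma> \<in> sections_on B U" "0 < \<epsilon>" "j \<in> index B"
    "\<alpha> \<in> tube B U \<sigma> \<epsilon> j" "tube B U \<sigma> \<epsilon> j \<subseteq> W"
proof -
  obtain T where "\<exists>U \<sigma> \<epsilon> j. openin (base B) U \<and> \<sigma> \<in> sections_on B U \<and> 0 < \<epsilon> \<and> j \<in> index B \<and>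
      T = tube B U \<sigma> \<epsilon> j" "\<alpha> \<in> T" "T \<subseteq> W"
    using assms unfolding tube_base arbitrary_union_of_alt by meson
  then show ?thesis using that by (elim exE conjE) simp
qed

lemma sections_onD:
  assumes "\<sigma> \<in> sections_on B U"
  shows "\<And>x. x \<in> U \<Longrightarrow> \<sigma> x \<in> carrier (stalk B x)"
    and "continuous_map (subtopology (base B) U) (total B) \<sigma>"
    and "\<And>j. j \<in> index B \<Longrightarrow> bdd_above ((\<lambda>x. seminorm B j (\<sigma> x)) ` U)"
  using assms by (auto simp: sections_on_def)

lemma sections_on_subset:
  assumes "\<sigma> \<in> sections B" "U \<subseteq> topspace (base B)"
  shows "\<sigma> \<in> sections_on B U"
proof -
  have "bdd_above ((\<lambda>x. seminorm B j (\<sigma> x)) ` U)" if "j \<in> index B" for j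
    using bdd_above_mono[OF sections_onD(3)[OF assms(1) that] image_mono[OF assms(2)]] .
  then show ?thesis
    using assms by (auto simp: sections_on_def continuous_map_from_subtopology)
qed

text \<open>Continuity is that of the fibrewise addition composed with the pair of sections; the
  bounds add up by subadditivity.\<close>

lemma sections_add:
  assumes \<sigma>: "\<sigma> \<in> sections B" and \<tau>: "\<tau> \<in> sections B"
  shows "(\<lambda>x. \<sigma> x \<oplus>\<^bsub>stalk B x\<^esub> \<tau> x) \<in> sections B"
proof -
  note s = sections_onD[OF \<sigma>] and t = sections_onD[OF \<tau>]
  have proj: "proj B (\<sigma> x) = x" "proj B (\<tau> x) = x" if "x \<in> topspace (base B)" for x
    using s(1)[OF that] t(1)[OF that] carrier_stalk[OF that] by auto
  have add: "continuous_map
       (subtopology (prod_topology (total B) (total B)) {(\<alpha>, \<beta>). proj B \<alpha> = proj B \<beta>})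
       (total B) (\<lambda>(\<alpha>, \<beta>). \<alpha> \<oplus>\<^bsub>stalk B (proj B \<alpha>)\<^esub> \<beta>)"
    using omega by (simp add: bundle_of_omega_spaces_def)
  \<comment> \<open>Both sections take values over the same point, so the pair lands in the fibre
    product on which addition is continuous.\<close>
  have pair: "continuous_map (base B)
       (subtopology (prod_topology (total B) (total B)) {(\<alpha>, \<beta>). proj B \<alpha> = proj B \<beta>})
       (\<lambda>x. (\<sigma> x, \<tau> x))"
    using s(2) t(2) proj by (auto simp: continuous_map_in_subtopology continuous_map_paired)
  have "continuous_map (base B) (total B) (\<lambda>x. \<sigma> x \<oplus>\<^bsub>stalk B x\<^esub> \<tau> x)"
    by (rule continuous_map_eq[OF continuous_map_compose[OF pair add]]) (simp add: proj)
  moreover have "bdd_above ((\<lambda>x. seminorm B j (\<sigma> x \<oplus>\<^bsub>stalk B x\<^esub> \<tau> x)) ` topspace (base B))"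
    if j: "j \<in> index B" for j
  proof -
    obtain M N where M: "\<And>x. x \<in> topspace (base B) \<Longrightarrow> seminorm B j (\<sigma> x) \<le> M"
      and N: "\<And>x. x \<in> topspace (base B) \<Longrightarrow> seminorm B j (\<tau> x) \<le> N"
      using s(3)[OF j] t(3)[OF j] by (auto simp: bdd_above_def)
    have "seminorm B j (\<sigma> x \<oplus>\<^bsub>stalk B x\<^esub> \<tau> x) \<le> M + N" if "x \<in> topspace (base B)" for x
      using seminorm_add[OF that j s(1)[OF that] t(1)[OF that]] M[OF that] N[OF that] by linarith
    then show ?thesis by (rule bdd_aboveI2)
  qed
  moreover have "\<sigma> x \<oplus>\<^bsub>stalk B x\<^esub> \<tau> x \<in> carrier (stalk B x)" if "x \<in> topspace (base B)" for x
    using abelian_groupE(1)[OF stalk_abelian_group[OF that]] s(1)[OF that] t(1)[OF that] by blast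
  ultimately show ?thesis by (simp add: sections_on_def)
qed

lemma sections_smult:
  assumes \<sigma>: "\<sigma> \<in> sections B" and c: "c \<in> K"
  shows "(\<lambda>x. c \<odot>\<^bsub>stalk B x\<^esub> \<sigma> x) \<in> sections B"
proof -
  note s = sections_onD[OF \<sigma>]
  have proj: "proj B (\<sigma> x) = x" if "x \<in> topspace (base B)" for x
    using s(1)[OF that] carrier_stalk[OF that] by auto
  have smult: "continuous_map (prod_topology (top_of_set K) (total B)) (total B)
       (\<lambda>(c, \<alpha>). c \<odot>\<^bsub>stalk B (proj B \<alpha>)\<^esub> \<alpha>)"
    using omega by (simp add: bundle_of_omega_spaces_def)
  have pair: "continuous_map (base B) (prod_topology (top_of_set K) (total B)) (\<lambda>x. (c, \<sigma> x))"
    using s(2) c by (auto simp: continuous_map_paired)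
  have "continuous_map (base B) (total B) (\<lambda>x. c \<odot>\<^bsub>stalk B x\<^esub> \<sigma> x)"
    by (rule continuous_map_eq[OF continuous_map_compose[OF pair smult]]) (simp add: proj)
  moreover have "bdd_above ((\<lambda>x. seminorm B j (c \<odot>\<^bsub>stalk B x\<^esub> \<sigma> x)) ` topspace (base B))"
    if j: "j \<in> index B" for j
  proof -
    obtain M where M: "\<And>x. x \<in> topspace (base B) \<Longrightarrow> seminorm B j (\<sigma> x) \<le> M"
      using s(3)[OF j] by (auto simp: bdd_above_def)
    have "seminorm B j (c \<odot>\<^bsub>stalk B x\<^esub> \<sigma> x) \<le> cmod c * M" if "x \<in> topspace (base B)" for x
      using seminorm_smult[OF that j c s(1)[OF that]] M[OF that] by (simp add: mult_left_mono)
    then show ?thesis by (rule bdd_aboveI2)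
  qed
  moreover have "c \<odot>\<^bsub>stalk B x\<^esub> \<sigma> x \<in> carrier (stalk B x)" if "x \<in> topspace (base B)" for x
    using module.smult_closed[OF stalk_module[OF that]] s(1)[OF that] c by simp
  ultimately show ?thesis by (simp add: sections_on_def)
qed

text \<open>Elements of a product module are functions cut off outside the base, so their components
  agree with natural sections only on the base; this lemma bridges the difference.\<close>

lemma sections_cong:
  assumes "\<sigma> \<in> sections B" "\<And>x. x \<in> topspace (base B) \<Longrightarrow> \<tau> x = \<sigma> x"
  shows "\<tau> \<in> sections B"
proof -
  have "(\<lambda>x. seminorm B j (\<tau> x)) ` topspace (base B)
      = (\<lambda>x. seminorm B j (\<sigma> x)) ` topspace (base B)" for j
    using assms(2) by (intro image_cong) auto
  moreover have "continuous_map (base B) (total B) \<tau>"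
    by (rule continuous_map_eq[of _ _ \<sigma>]) (use assms in \<open>auto simp: sections_on_def\<close>)
  ultimately show ?thesis
    using assms by (auto simp: sections_on_def)
qed

end

section \<open>Full bundles: global sections as centres of tubes\<close>

locale full_omega_space_bundle = omega_space_bundle +
  assumes full: "full_bundle B"
begin

lemma section_through:
  assumes "x \<in> topspace (base B)" "a \<in> carrier (stalk B x)"
  obtains g where "g \<in> sections B" "g x = a"
proof -
  have "a \<in> topspace (total B)" "proj B a = x"
    using assms carrier_stalk[OF assms(1)] by auto
  then show ?thesis
    using full that unfolding full_bundle_def by metis
qed

text \<open>Over a nonempty base fullness supplies some global section, and its multiple by the
  scalar 0 is the zero section. Over an empty base all conditions are vacuous.\<close>

lemma zero_section: "(\<lambda>x. \<zero>\<^bsub>stalk B x\<^esub>) \<in> sections B"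
proof (cases "topspace (base B) = {}")
  case True
  then show ?thesis
    by (auto simp: sections_on_def continuous_map_def)
next
  case False
  then obtain x where x: "x \<in> topspace (base B)" by blast
  obtain g where g: "g \<in> sections B"
    using section_through[OF x abelian_groupE(2)[OF stalk_abelian_group[OF x]]] by blast
  have "0 \<odot>\<^bsub>stalk B y\<^esub> g y = \<zero>\<^bsub>stalk B y\<^esub>" if "y \<in> topspace (base B)" for y
    using module.smult_l_null[OF stalk_module[OF that] sections_onD(1)[OF g that]] by simp
  then show ?thesis
    using sections_cong[OF sections_smult[OF g zero_scalar]] by simp
qed

text \<open>Fullness lets the local section that defines a tube around \<open>a\<close> be replaced by a global
  section \<open>g\<close> through \<open>a\<close>, at the cost of shrinking the tube.\<close>

lemma global_tube_neighbourhood: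
  assumes W: "openin (total B) W" "a \<in> W" and x: "x \<in> topspace (base B)"
    and g: "g \<in> sections B" "g x = a"
  obtains U \<epsilon> j where "openin (base B) U" "x \<in> U" "0 < \<epsilon>" "j \<in> index B" "tube B U g \<epsilon> j \<subseteq> W"
proof -
  obtain U \<sigma> \<epsilon> j where U: "openin (base B) U" and \<sigma>: "\<sigma> \<in> sections_on B U" and "0 < \<epsilon>"
    and j: "j \<in> index B" and a: "a \<in> tube B U \<sigma> \<epsilon> j" and sub: "tube B U \<sigma> \<epsilon> j \<subseteq> W"
    using tube_neighbourhood[OF W] by metis
  have ga: "proj B (g y) = y" "g y \<in> topspace (total B)" if "y \<in> topspace (base B)" for y
    using sections_onD(1)[OF g(1) that] carrier_stalk[OF that] by auto
  have px: "proj B a = x" using ga[OF x] g(2) by simp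
  define r where "r = seminorm B j (a \<ominus>\<^bsub>stalk B x\<^esub> \<sigma> x)"
  have xU: "x \<in> U" and r: "r < \<epsilon>" using a px by (auto simp: tube_def r_def)
  have r0: "0 \<le> r"
    unfolding r_def
    using sections_onD(1)[OF g(1) x] sections_onD(1)[OF \<sigma> xU] g(2)
    by (intro seminorm_nonneg[OF x j])
      (auto intro: abelian_group.minus_closed[OF stalk_abelian_group[OF x]])
  \<comment> \<open>The midpoint splits the radius: the tube of radius \<eta> about \<sigma> still
    contains \<open>a\<close>, and \<epsilon> - \<eta> remains as the radius of the new tube about
    \<open>g\<close>.\<close>
  define \<eta> where "\<eta> = (r + \<epsilon>) / 2"
  have \<eta>: "r < \<eta>" "\<eta> < \<epsilon>" "0 < \<eta>" using r r0 by (auto simp: \<eta>_def)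
  \<comment> \<open>Over \<open>U'\<close> the section \<open>g\<close> stays within \<eta> of
    \<sigma>. This set is open as the preimage of an open tube under \<open>g\<close>, and the same
    seminorm \<open>j\<close> can be kept.\<close>
  define U' where "U' = {y \<in> topspace (base B). g y \<in> tube B U \<sigma> \<eta> j}"
  have "openin (base B) U'"
    unfolding U'_def using sections_onD(2)[OF g(1)] openin_tube[OF U \<sigma> \<eta>(3) j]
    by (auto simp: continuous_map_def)
  moreover have "x \<in> U'"
    using x xU \<eta> px g(2) ga[OF x] by (auto simp: U'_def tube_def r_def)
  moreover have "tube B U' g (\<epsilon> - \<eta>) j \<subseteq> tube B U \<sigma> \<epsilon> j"
  proof
    fix b assume b: "b \<in> tube B U' g (\<epsilon> - \<eta>) j"
    define y where "y = proj B b"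
    have y: "y \<in> topspace (base B)" "y \<in> U" and bt: "b \<in> topspace (total B)"
      and lt: "seminorm B j (b \<ominus>\<^bsub>stalk B y\<^esub> g y) < \<epsilon> - \<eta>"
      and lt': "seminorm B j (g y \<ominus>\<^bsub>stalk B y\<^esub> \<sigma> y) < \<eta>"
      using b ga by (auto simp: tube_def U'_def y_def)
    have "seminorm B j (b \<ominus>\<^bsub>stalk B y\<^esub> \<sigma> y) < \<epsilon>"
      using seminorm_triangle[OF y(1) j _ sections_onD(1)[OF g(1) y(1)] sections_onD(1)[OF \<sigma> y(2)], of b]
        bt carrier_stalk[OF y(1)] lt lt' by (auto simp: y_def)
    then show "b \<in> tube B U \<sigma> \<epsilon> j"
      using bt y by (auto simp: tube_def y_def)
  qed
  ultimately show ?thesis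
    using that[of U' "\<epsilon> - \<eta>" j] \<eta> j sub by auto
qed

end


section \<open>The direct sum: stalks and seminorms\<close>

locale full_bundle_family =
  fixes K :: "complex set" and X :: "'x topology" and n :: nat
    and V :: "nat \<Rightarrow> ('x, 'e, 'j) omega_bundle"
  assumes K: "K = \<real> \<or> K = UNIV"
    and omega: "\<And>i. i \<in> {1..n} \<Longrightarrow> bundle_of_omega_spaces K (V i)"
    and full: "\<And>i. i \<in> {1..n} \<Longrightarrow> full_bundle (V i)"
    and base: "\<And>i. i \<in> {1..n} \<Longrightarrow> base (V i) = X"
begin

lemma summand: "i \<in> {1..n} \<Longrightarrow> full_omega_space_bundle K (V i)"
  using K omega full
  by (simp add: full_omega_space_bundle_def full_omega_space_bundle_axioms_def
      omega_space_bundle_def)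

lemmas summand' = full_omega_space_bundle.axioms(1)[OF summand]

lemma summand_stalk_module:
  "\<lbrakk>i \<in> {1..n}; x \<in> topspace X\<rbrakk> \<Longrightarrow> vector_space_over K (stalk (V i) x)"
  using omega_space_bundle.stalk_module[OF summand'] base by metis

lemma sum_space_module: "x \<in> topspace X \<Longrightarrow> vector_space_over K (sum_space n V x)"
  unfolding sum_space_def
  by (intro module_product_module cring_scalars K summand_stalk_module)

lemma carrier_sum_space: "carrier (sum_space n V x) = (\<Pi>\<^sub>E i\<in>{1..n}. carrier (stalk (V i) x))"
  by (simp add: sum_space_def)

text \<open>Subtraction is componentwise, and the difference lies in the carrier, where
  \<open>sum_Pr\<close> is plain evaluation at \<open>i\<close>.\<close>

lemma sum_seminorm_minus:
  assumes x: "x \<in> topspace X"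
    and v: "v \<in> carrier (sum_space n V x)" and w: "w \<in> carrier (sum_space n V x)"
  shows "sum_seminorm n V \<rho> x (v \<ominus>\<^bsub>sum_space n V x\<^esub> w)
    = (\<Sum>i=1..n. seminorm (V i) (\<rho> i) (v i \<ominus>\<^bsub>stalk (V i) x\<^esub> w i))"
proof -
  have ab: "abelian_group (stalk (V i) x)" if "i \<in> {1..n}" for i
    using summand_stalk_module[OF that x] by (simp add: Module.module_def)
  have ab': "abelian_group (sum_space n V x)"
    using sum_space_module[OF x] by (simp add: Module.module_def)
  have "v \<ominus>\<^bsub>sum_space n V x\<^esub> w = (\<lambda>i\<in>{1..n}. v i \<ominus>\<^bsub>stalk (V i) x\<^esub> w i)"
    using ab v w ab' unfolding sum_space_def by (rule product_module_minus)
  moreover have "v \<ominus>\<^bsub>sum_space n V x\<^esub> w \<in> carrier (sum_space n V x)"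
    using abelian_group.minus_closed[OF ab' v w] .
  ultimately show ?thesis
    by (auto simp: sum_seminorm_def sum_Pr_def intro!: sum.cong)
qed

section \<open>The span of the included sections, described by components\<close>

lemma sum_sections_module:
  "vector_space_over K (product_module (topspace X) (sum_space n V))"
  by (intro module_product_module cring_scalars K sum_space_module)

text \<open>The families all of whose components are global sections form a submodule, since
  sections are closed under sums and scalar multiples. It contains the generators, hence also their
  span.\<close>

lemma sum_sections_components:
  assumes \<sigma>: "\<sigma> \<in> sum_sections K X n V"
  shows "\<And>x. x \<in> topspace X \<Longrightarrow> \<sigma> x \<in> carrier (sum_space n V x)"
    and "\<And>i. i \<in> {1..n} \<Longrightarrow> (\<lambda>x. \<sigma> x i) \<in> sections (V i)"
proof -
  let ?M = "product_module (topspace X) (sum_space n V)"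
  define H where "H = {\<sigma> \<in> carrier ?M. \<forall>i\<in>{1..n}. (\<lambda>x. \<sigma> x i) \<in> sections (V i)}"
  interpret M: module "scalars K" ?M by (rule sum_sections_module)
  have cong: "\<tau> \<in> sections (V i)"
    if "i \<in> {1..n}" "\<sigma> \<in> sections (V i)" "\<And>x. x \<in> topspace X \<Longrightarrow> \<tau> x = \<sigma> x" for i \<sigma> \<tau>
    using omega_space_bundle.sections_cong[OF summand'[OF that(1)] that(2)] that base by metis
  have zero: "(\<lambda>x. \<zero>\<^bsub>stalk (V i) x\<^esub>) \<in> sections (V i)" if "i \<in> {1..n}" for i
    using full_omega_space_bundle.zero_section[OF summand[OF that]] .
  have "submodule H (scalars K) ?M"
  proof (rule M.submodule_if_closed)
    show "H \<subseteq> carrier ?M" by (auto simp: H_def)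
    show "\<zero>\<^bsub>?M\<^esub> \<in> H"
    proof -
      have "(\<lambda>x. \<zero>\<^bsub>?M\<^esub> x i) \<in> sections (V i)" if i: "i \<in> {1..n}" for i
        by (rule cong[OF i zero[OF i]]) (use i in \<open>simp add: sum_space_def\<close>)
      then show ?thesis unfolding H_def using M.zero_closed by blast
    qed
    fix a b assume a: "a \<in> H" and b: "b \<in> H"
    then have "a \<oplus>\<^bsub>?M\<^esub> b \<in> carrier ?M" by (intro M.a_closed) (auto simp: H_def)
    moreover have "(\<lambda>x. (a \<oplus>\<^bsub>?M\<^esub> b) x i) \<in> sections (V i)" if i: "i \<in> {1..n}" for i
      by (rule cong[OF i omega_space_bundle.sections_add[OF summand'[OF i], of "\<lambda>x. a x i" "\<lambda>x. b x i"]])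
        (use a b i in \<open>auto simp: H_def sum_space_def\<close>)
    ultimately show "a \<oplus>\<^bsub>?M\<^esub> b \<in> H" by (simp add: H_def)
  next
    fix c b assume c: "c \<in> carrier (scalars K)" and b: "b \<in> H"
    then have "c \<odot>\<^bsub>?M\<^esub> b \<in> carrier ?M" by (intro M.smult_closed) (auto simp: H_def)
    moreover have "(\<lambda>x. (c \<odot>\<^bsub>?M\<^esub> b) x i) \<in> sections (V i)" if i: "i \<in> {1..n}" for i
      by (rule cong[OF i omega_space_bundle.sections_smult[OF summand'[OF i], of "\<lambda>x. b x i" c]])
        (use c b i in \<open>auto simp: H_def sum_space_def\<close>)
    ultimately show "c \<odot>\<^bsub>?M\<^esub> b \<in> H" by (simp add: H_def)
  qed
  moreover have "(\<lambda>x\<in>topspace X. sum_In n V i x (g x)) \<in> H"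
    if i: "i \<in> {1..n}" and g: "g \<in> sections (V i)" for i g
  proof -
    have "sum_In n V i x (g x) \<in> carrier (sum_space n V x)" if x: "x \<in> topspace X" for x
      using omega_space_bundle.sections_onD(1)[OF summand'[OF i] g, of x] x base[OF i]
        abelian_groupE(2)[OF module.axioms(2)[OF summand_stalk_module[OF _ x]]]
      by (auto simp: sum_In_def carrier_sum_space)
    \<comment> \<open>The component of a generator is \<open>g\<close> at its own index and the zero
      section at every other one.\<close>
    moreover have "(\<lambda>x. (\<lambda>x\<in>topspace X. sum_In n V i x (g x)) x k) \<in> sections (V k)"
      if k: "k \<in> {1..n}" for k
    proof (cases "k = i")
      case True
      show ?thesis
        by (rule cong[OF k]) (use g True i in \<open>auto simp: sum_In_def\<close>)
    next
      case False
      show ?thesis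
        by (rule cong[OF k zero[OF k]]) (use k False in \<open>auto simp: sum_In_def\<close>)
    qed
    ultimately show ?thesis by (auto simp: H_def)
  qed
  ultimately have "sum_sections K X n V \<subseteq> H"
    unfolding sum_sections_def linear_span_def by (intro hull_minimal) auto
  then have "\<sigma> \<in> H" using \<sigma> by blast
  then show "\<And>x. x \<in> topspace X \<Longrightarrow> \<sigma> x \<in> carrier (sum_space n V x)"
    and "\<And>i. i \<in> {1..n} \<Longrightarrow> (\<lambda>x. \<sigma> x i) \<in> sections (V i)"
    by (auto simp: H_def)
qed

text \<open>The family is the sum over \<open>i\<close> of the generators built from
  \<open>g i\<close>. As the span is the intersection of all submodules containing the generators,
  it suffices to form this sum inside an arbitrary such submodule.\<close>

lemma sum_sections_combine:
  assumes g: "\<And>i. i \<in> {1..n} \<Longrightarrow> g i \<in> sections (V i)"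
  shows "(\<lambda>x\<in>topspace X. \<lambda>i\<in>{1..n}. g i x) \<in> sum_sections K X n V"
proof -
  let ?M = "product_module (topspace X) (sum_space n V)"
  \<comment> \<open>\<open>s m\<close> is the sum of the first \<open>m\<close> generators, so
    \<open>s 0\<close> is zero and \<open>s n\<close> is the desired family.\<close>
  define s where "s m = (\<lambda>x\<in>topspace X. \<lambda>i\<in>{1..n}. if i \<le> m then g i x else \<zero>\<^bsub>stalk (V i) x\<^esub>)" for m
  have mem: "g i x \<in> carrier (stalk (V i) x)" if "i \<in> {1..n}" "x \<in> topspace X" for i x
    using omega_space_bundle.sections_onD(1)[OF summand'[OF that(1)] g[OF that(1)]] that base by metis
  have ab: "abelian_group (stalk (V i) x)" if "i \<in> {1..n}" "x \<in> topspace X" for i x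
    using summand_stalk_module[OF that] by (simp add: Module.module_def)
  have "s n \<in> H" if H: "submodule H (scalars K) ?M"
    and gens: "{(\<lambda>x\<in>topspace X. sum_In n V i x (g x)) | i g. i \<in> {1..n} \<and> g \<in> sections (V i)} \<subseteq> H"
  for H
  proof -
    have sg: "subgroup H (add_monoid ?M)" using H by (simp add: submodule_def)
    have "m \<le> n \<Longrightarrow> s m \<in> H" for m
    proof (induction m)
      case 0
      have "s 0 = \<zero>\<^bsub>?M\<^esub>" by (auto simp: s_def sum_space_def fun_eq_iff)
      then show ?case using subgroup.one_closed[OF sg] by (simp del: product_module_simps)
    next
      case (Suc m)
      let ?t = "\<lambda>x\<in>topspace X. sum_In n V (Suc m) x (g (Suc m) x)"
      have "?t \<in> H" using gens g[of "Suc m"] Suc.prems by force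
      then have "s m \<oplus>\<^bsub>?M\<^esub> ?t \<in> H"
        using subgroup.m_closed[OF sg, of "s m" ?t] Suc by simp
      moreover have "s m \<oplus>\<^bsub>?M\<^esub> ?t = s (Suc m)"
      proof (intro ext)
        fix x i
        show "(s m \<oplus>\<^bsub>?M\<^esub> ?t) x i = s (Suc m) x i"
        proof (cases "x \<in> topspace X \<and> i \<in> {1..n}")
          case True
          then show ?thesis
            using mem[of i x] abelian_groupE(2)[OF ab, of i x]
              abelian_monoid.r_zero[OF abelian_group.axioms(1)[OF ab], of i x]
              abelian_monoid.l_zero[OF abelian_group.axioms(1)[OF ab], of i x]
            by (auto simp: s_def sum_In_def sum_space_def le_Suc_eq)
        qed (auto simp: s_def sum_space_def)
      qed
      ultimately show ?case by simp
    qed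
    then show ?thesis by simp
  qed
  then have "s n \<in> sum_sections K X n V"
    unfolding sum_sections_def linear_span_def hull_def by blast
  moreover have "s n = (\<lambda>x\<in>topspace X. \<lambda>i\<in>{1..n}. g i x)"
    by (auto simp: s_def fun_eq_iff)
  ultimately show ?thesis by simp
qed

section \<open>Comparison of the tube topology with the induced product topology\<close>

text \<open>This is the fibre product of the total spaces over \<open>X\<close>, with the base point
  kept as an extra coordinate so that it is remembered even for \<open>n = 0\<close>.\<close>

definition product_top :: "('x \<times> (nat \<Rightarrow> 'e)) topology" where
  "product_top = subtopology (prod_topology X (product_topology (\<lambda>i. total (V i)) {1..n}))
     (SIGMA x:topspace X. carrier (sum_space n V x))"

lemma carrier_summand_stalk:
  "\<lbrakk>i \<in> {1..n}; x \<in> topspace X\<rbrakk> \<Longrightarrow>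
    carrier (stalk (V i) x) = {\<alpha> \<in> topspace (total (V i)). proj (V i) \<alpha> = x}"
  using omega_space_bundle.carrier_stalk[OF summand'] base by metis

text \<open>Around a point of the tube, each component may move by a fixed share of the slack in the
  radius. This gives a box of tubes of the summands, open in the product, that fits into the given
  tube.\<close>

lemma openin_sum_tube:
  assumes U: "openin X U" and \<sigma>: "\<sigma> \<in> sum_sections K X n V" and \<rho>: "\<rho> \<in> sum_index n V"
  shows "openin product_top (sum_tube X n V U \<sigma> \<epsilon> \<rho>)"
proof (subst openin_subopen, safe)
  fix x v assume xv: "(x, v) \<in> sum_tube X n V U \<sigma> \<epsilon> \<rho>"
  note \<sigma>C = sum_sections_components(1)[OF \<sigma>] and \<sigma>S = sum_sections_components(2)[OF \<sigma>]
  have UX: "U \<subseteq> topspace X" using U by (rule openin_subset)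
  have x: "x \<in> topspace X" "x \<in> U" and v: "v \<in> carrier (sum_space n V x)"
    and lt: "sum_seminorm n V \<rho> x (v \<ominus>\<^bsub>sum_space n V x\<^esub> \<sigma> x) < \<epsilon>"
    using xv by (auto simp: sum_tube_def)
  have \<rho>i: "\<rho> i \<in> index (V i)" if "i \<in> {1..n}" for i
    using \<rho> that by (auto simp: sum_index_def)
  define a where "a i = seminorm (V i) (\<rho> i) (v i \<ominus>\<^bsub>stalk (V i) x\<^esub> \<sigma> x i)" for i
  have a0: "0 \<le> a i" if i: "i \<in> {1..n}" for i
  proof -
    have "v i \<ominus>\<^bsub>stalk (V i) x\<^esub> \<sigma> x i \<in> carrier (stalk (V i) x)"
      using v \<sigma>C[OF x(1)] i
      by (intro abelian_group.minus_closed[OF module.axioms(2)[OF summand_stalk_module[OF i x(1)]]])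
        (auto simp: carrier_sum_space)
    then show ?thesis
      unfolding a_def using omega_space_bundle.seminorm_nonneg[OF summand'[OF i]] x(1) base[OF i] \<rho>i[OF i]
      by metis
  qed
  have sum_a: "(\<Sum>i=1..n. a i) < \<epsilon>"
    using lt sum_seminorm_minus[OF x(1) v \<sigma>C[OF x(1)]] by (simp add: a_def)
  \<comment> \<open>The slack is divided by \<open>n + 1\<close> instead of \<open>n\<close>: one
    share is left over, which makes the final inequality strict and covers
    \<open>n = 0\<close>.\<close>
  define \<delta> where "\<delta> = (\<epsilon> - (\<Sum>i=1..n. a i)) / (real n + 1)"
  have \<delta>: "0 < \<delta>" and "(\<Sum>i=1..n. a i) + (real n + 1) * \<delta> = \<epsilon>"
    using sum_a by (auto simp: \<delta>_def field_simps)
  then have sum_le: "(\<Sum>i=1..n. a i + \<delta>) < \<epsilon>"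
    by (simp add: sum.distrib algebra_simps)
  define T where "T = (U \<times> (\<Pi>\<^sub>E i\<in>{1..n}. tube (V i) U (\<lambda>y. \<sigma> y i) (a i + \<delta>) (\<rho> i)))
      \<inter> (SIGMA x:topspace X. carrier (sum_space n V x))"
  have "openin (total (V i)) (tube (V i) U (\<lambda>y. \<sigma> y i) (a i + \<delta>) (\<rho> i))" if i: "i \<in> {1..n}" for i
    using omega_space_bundle.openin_tube[OF summand'[OF i] _ 
        omega_space_bundle.sections_on_subset[OF summand'[OF i] \<sigma>S[OF i]]]
      base[OF i] U UX a0[OF i] \<delta> \<rho>i[OF i] by simp
  then have "openin product_top T"
    unfolding T_def product_top_def
    by (intro openin_subtopology_Int) (auto simp: openin_prod_Times_iff openin_PiE_gen U)
  moreover have "(x, v) \<in> T"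
    using x v \<delta> carrier_summand_stalk[OF _ x(1)]
    by (auto simp: T_def carrier_sum_space tube_def PiE_iff a_def)
  moreover have "T \<subseteq> sum_tube X n V U \<sigma> \<epsilon> \<rho>"
  proof (safe)
    fix y w assume yw: "(y, w) \<in> T"
    then have y: "y \<in> topspace X" "y \<in> U" and w: "w \<in> carrier (sum_space n V y)"
      by (auto simp: T_def)
    \<comment> \<open>A weak bound suffices, as strictness already comes from the leftover share of
      the slack.\<close>
    have "seminorm (V i) (\<rho> i) (w i \<ominus>\<^bsub>stalk (V i) y\<^esub> \<sigma> y i) \<le> a i + \<delta>" if i: "i \<in> {1..n}" for i
    proof -
      have "w i \<in> tube (V i) U (\<lambda>y. \<sigma> y i) (a i + \<delta>) (\<rho> i)" using yw i by (auto simp: T_def)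
      moreover have "proj (V i) (w i) = y"
        using w i carrier_summand_stalk[OF i y(1)] by (auto simp: carrier_sum_space)
      ultimately show ?thesis by (simp add: tube_def)
    qed
    then have "(\<Sum>i=1..n. seminorm (V i) (\<rho> i) (w i \<ominus>\<^bsub>stalk (V i) y\<^esub> \<sigma> y i)) < \<epsilon>"
      using sum_le by (intro le_less_trans[OF sum_mono sum_le]) auto
    then show "(y, w) \<in> sum_tube X n V U \<sigma> \<epsilon> \<rho>"
      using y w sum_seminorm_minus[OF y(1) w \<sigma>C[OF y(1)]] by (simp add: sum_tube_def)
  qed
  ultimately show "\<exists>T. openin product_top T \<and> (x, v) \<in> T \<and> T \<subseteq> sum_tube X n V U \<sigma> \<epsilon> \<rho>"
    by blast
qed

text \<open>Shrink \<open>W\<close> to a box, and each factor of the box to a tube about a global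
  section through the component of \<open>v\<close>. These sections combine to one of the sum with
  value \<open>v\<close> at \<open>x\<close>, and a tube about it with the least of the radii lies
  in the box, because each summand of the seminorm is at most the sum.\<close>

lemma sum_tube_neighbourhood:
  assumes W: "openin product_top W" "(x, v) \<in> W"
  shows "\<exists>U \<sigma> \<epsilon> \<rho>. openin X U \<and> \<sigma> \<in> sum_sections K X n V \<and> 0 < \<epsilon> \<and> \<rho> \<in> sum_index n V \<and>
          (x, v) \<in> sum_tube X n V U \<sigma> \<epsilon> \<rho> \<and> sum_tube X n V U \<sigma> \<epsilon> \<rho> \<subseteq> W"
proof -
  let ?S = "SIGMA x:topspace X. carrier (sum_space n V x)"
  obtain W' where W': "openin (prod_topology X (product_topology (\<lambda>i. total (V i)) {1..n})) W'"
    and WW': "W = W' \<inter> ?S"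
    using W(1) by (auto simp: product_top_def openin_subtopology)
  have x: "x \<in> topspace X" and v: "v \<in> carrier (sum_space n V x)" using W(2) WW' by auto
  obtain A B where A: "openin X A" "x \<in> A" and B: "openin (product_topology (\<lambda>i. total (V i)) {1..n}) B" "v \<in> B"
    and AB: "A \<times> B \<subseteq> W'"
    using W'[unfolded openin_prod_topology_alt, rule_format, of x v] W(2) WW' by blast
  obtain O' where O: "\<And>i. i \<in> {1..n} \<Longrightarrow> openin (total (V i)) (O' i)" "v \<in> PiE {1..n} O'" "PiE {1..n} O' \<subseteq> B"
    using B(1)[unfolded openin_product_topology_alt, rule_format, OF B(2)] by (elim exE conjE) blast
  have "\<exists>g U e j. g \<in> sections (V i) \<and> g x = v i \<and> openin X U \<and> x \<in> U \<and> 0 < e \<and> j \<in> index (V i) \<and>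
      tube (V i) U g e j \<subseteq> O' i" if i: "i \<in> {1..n}" for i
  proof -
    interpret full_omega_space_bundle K "V i" using i by (rule summand)
    have vi: "v i \<in> carrier (stalk (V i) x)" "v i \<in> O' i"
      using v i O(2) by (auto simp: carrier_sum_space)
    have xb: "x \<in> topspace (omega_bundle.base (V i))" using x base[OF i] by simp
    obtain g where g: "g \<in> sections (V i)" "g x = v i"
      using section_through[OF xb vi(1)] by blast
    obtain U e j where "openin (omega_bundle.base (V i)) U" "x \<in> U" "0 < e" "j \<in> index (V i)"
      "tube (V i) U g e j \<subseteq> O' i"
      using global_tube_neighbourhood[OF O(1)[OF i] vi(2) xb g] by metis
    then show ?thesis using g base[OF i] by metis
  qed
  then have "\<forall>i\<in>{1..n}. \<exists>g U e j. g \<in> sections (V i) \<and> g x = v i \<and> openin X U \<and> x \<in> U \<and> 0 < e \<and>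
      j \<in> index (V i) \<and> tube (V i) U g e j \<subseteq> O' i"
    by blast
  then obtain g U e j where choice:
    "\<forall>i\<in>{1..n}. g i \<in> sections (V i) \<and> g i x = v i \<and> openin X (U i) \<and> x \<in> U i \<and> 0 < e i \<and>
      j i \<in> index (V i) \<and> tube (V i) (U i) (g i) (e i) (j i) \<subseteq> O' i"
    unfolding bchoice_iff by (elim exE)
  have
    g: "\<And>i. i \<in> {1..n} \<Longrightarrow> g i \<in> sections (V i)" "\<And>i. i \<in> {1..n} \<Longrightarrow> g i x = v i"
    and U: "\<And>i. i \<in> {1..n} \<Longrightarrow> openin X (U i)" "\<And>i. i \<in> {1..n} \<Longrightarrow> x \<in> U i"
    and e: "\<And>i. i \<in> {1..n} \<Longrightarrow> (0::real) < e i"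
    and j: "\<And>i. i \<in> {1..n} \<Longrightarrow> j i \<in> index (V i)"
    and tubes: "\<And>i. i \<in> {1..n} \<Longrightarrow> tube (V i) (U i) (g i) (e i) (j i) \<subseteq> O' i"
    using choice by simp_all
  define \<sigma> where "\<sigma> = (\<lambda>x\<in>topspace X. \<lambda>i\<in>{1..n}. g i x)"
  define \<rho> where "\<rho> = restrict j {1..n}"
  \<comment> \<open>The extra 1 keeps the minimum meaningful for \<open>n = 0\<close>.\<close>
  define \<epsilon> where "\<epsilon> = Min (insert 1 (e ` {1..n}))"
  \<comment> \<open>\<open>A\<close> controls the base coordinate of the box;
    \<open>topspace X\<close> keeps the intersection open when the family of the \<open>U i\<close>
    is empty.\<close>
  define U' where "U' = A \<inter> ((\<Inter>i\<in>{1..n}. U i) \<inter> topspace X)"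
  have "openin X U'"
    unfolding U'_def using U(1) by (intro openin_Int A openin_INT) auto
  moreover have \<sigma>: "\<sigma> \<in> sum_sections K X n V"
    unfolding \<sigma>_def using g(1) by (rule sum_sections_combine)
  moreover have "0 < \<epsilon>" using e by (auto simp: \<epsilon>_def)
  moreover have \<rho>: "\<rho> \<in> sum_index n V" using j by (auto simp: \<rho>_def sum_index_def)
  moreover have "(x, v) \<in> sum_tube X n V U' \<sigma> \<epsilon> \<rho>"
  proof -
    \<comment> \<open>The tube is centred exactly at \<open>v\<close> over \<open>x\<close>, so the
      distance to be estimated is zero.\<close>
    have "\<sigma> x = v" using v x g(2) by (auto simp: \<sigma>_def carrier_sum_space PiE_iff extensional_def fun_eq_iff)
    moreover have "seminorm (V i) (\<rho> i) (v i \<ominus>\<^bsub>stalk (V i) x\<^esub> v i) = 0" if i: "i \<in> {1..n}" for i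
    proof -
      have "v i \<ominus>\<^bsub>stalk (V i) x\<^esub> v i = \<zero>\<^bsub>stalk (V i) x\<^esub>"
        using abelian_group.r_neg[OF module.axioms(2)[OF summand_stalk_module[OF i x]]]
          PiE_mem[OF v[unfolded carrier_sum_space] i]
        by (simp add: a_minus_def)
      then show ?thesis
        using omega_space_bundle.seminorm_zero[OF summand'[OF i], of x "\<rho> i"] x base[OF i] j[OF i] i
        by (simp add: \<rho>_def)
    qed
    ultimately show ?thesis
      using x v A(2) U(2) \<open>0 < \<epsilon>\<close> sum_seminorm_minus[OF x v v] by (simp add: sum_tube_def U'_def)
  qed
  moreover have "sum_tube X n V U' \<sigma> \<epsilon> \<rho> \<subseteq> W"
  proof safe
    fix y w assume yw: "(y, w) \<in> sum_tube X n V U' \<sigma> \<epsilon> \<rho>"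
    then have y: "y \<in> topspace X" "y \<in> U'" and w: "w \<in> carrier (sum_space n V y)"
      and lt: "sum_seminorm n V \<rho> y (w \<ominus>\<^bsub>sum_space n V y\<^esub> \<sigma> y) < \<epsilon>"
      by (auto simp: sum_tube_def)
    let ?d = "\<lambda>i. seminorm (V i) (\<rho> i) (w i \<ominus>\<^bsub>stalk (V i) y\<^esub> \<sigma> y i)"
    note \<sigma>y = sum_sections_components(1)[OF \<sigma> y(1)]
    have wi: "w i \<in> carrier (stalk (V i) y)" "\<sigma> y i \<in> carrier (stalk (V i) y)" if "i \<in> {1..n}" for i
      using w \<sigma>y that by (auto simp: carrier_sum_space)
    have d0: "0 \<le> ?d i" if i: "i \<in> {1..n}" for i
    proof -
      have "w i \<ominus>\<^bsub>stalk (V i) y\<^esub> \<sigma> y i \<in> carrier (stalk (V i) y)"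
        using wi[OF i]
        by (intro abelian_group.minus_closed[OF module.axioms(2)[OF summand_stalk_module[OF i y(1)]]])
      then show ?thesis
        using omega_space_bundle.seminorm_nonneg[OF summand'[OF i], of y "\<rho> i"] y(1) base[OF i] j[OF i] i
        by (simp add: \<rho>_def)
    qed
    have "w i \<in> O' i" if i: "i \<in> {1..n}" for i
    proof -
      \<comment> \<open>Nonnegativity of all summands lets the sum control each component
        separately.\<close>
      have "?d i \<le> (\<Sum>i=1..n. ?d i)" using i d0 by (intro member_le_sum) auto
      also have "\<dots> < \<epsilon>" using lt sum_seminorm_minus[OF y(1) w \<sigma>y] by simp
      also have "\<epsilon> \<le> e i" unfolding \<epsilon>_def using i by (intro Min_le) auto
      finally have "w i \<in> tube (V i) (U i) (g i) (e i) (j i)"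
        using wi(1)[OF i] carrier_summand_stalk[OF i y(1)] y i
        by (auto simp: tube_def \<rho>_def \<sigma>_def U'_def)
      then show ?thesis using tubes[OF i] by blast
    qed
    then have "w \<in> PiE {1..n} O'" using w by (simp add: carrier_sum_space PiE_iff)
    then have "w \<in> B" using O(3) by blast
    then show "(y, w) \<in> W" using AB y w by (auto simp: WW' U'_def)
  qed
  ultimately show ?thesis by (intro exI conjI)
qed

text \<open>The two preceding lemmas show that the predicate inside \<open>sum_topology\<close> is
  openness in \<open>product_top\<close>. In particular it satisfies the axioms of a topology, as is
  required before \<open>topology\<close> can be unfolded.\<close>

lemma sum_topology_eq: "sum_topology K X n V = product_top"
proof -
  let ?S = "SIGMA y:topspace X. carrier (sum_space n V y)"
  have "(W \<subseteq> ?S \<and>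
       (\<forall>p\<in>W. \<exists>U \<sigma> \<epsilon> \<rho>. openin X U \<and> \<sigma> \<in> sum_sections K X n V \<and> 0 < \<epsilon> \<and> \<rho> \<in> sum_index n V \<and>
          p \<in> sum_tube X n V U \<sigma> \<epsilon> \<rho> \<and> sum_tube X n V U \<sigma> \<epsilon> \<rho> \<subseteq> W)) \<longleftrightarrow> openin product_top W"
    (is "?L \<longleftrightarrow> ?R") for W
  proof
    assume ?L
    then show ?R
      by (subst openin_subopen) (meson openin_sum_tube)
  next
    assume R: ?R
    then have "W \<subseteq> ?S" by (auto simp: product_top_def openin_subtopology)
    moreover have "\<exists>U \<sigma> \<epsilon> \<rho>. openin X U \<and> \<sigma> \<in> sum_sections K X n V \<and> 0 < \<epsilon> \<and> \<rho> \<in> sum_index n V \<and>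
          p \<in> sum_tube X n V U \<sigma> \<epsilon> \<rho> \<and> sum_tube X n V U \<sigma> \<epsilon> \<rho> \<subseteq> W" if "p \<in> W" for p
      using sum_tube_neighbourhood[OF R, of "fst p" "snd p"] that by simp
    ultimately show ?L by blast
  qed
  then show ?thesis
    by (simp add: sum_topology_def openin_inverse)
qed

lemma topspace_sum_topology:
  "topspace (sum_topology K X n V) = (SIGMA x:topspace X. carrier (sum_space n V x))"
  using carrier_summand_stalk
  by (auto simp: sum_topology_eq product_top_def carrier_sum_space PiE_iff)

section \<open>Componentwise continuity at a point\<close>

text \<open>Continuity is rephrased as convergence along \<open>atin X x\<close>. Limits in a
  subspace of a product are componentwise, and the base coordinate is the identity, which always
  converges; only the components in the summands remain.\<close>

lemma topcontinuous_at_sum_iff: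
  assumes f0: "\<And>z. z \<in> topspace X \<Longrightarrow> f0 z \<in> carrier (sum_space n V z)" and x: "x \<in> topspace X"
  shows "topcontinuous_at X (sum_topology K X n V) (\<lambda>z. (z, f0 z)) x \<longleftrightarrow>
    (\<forall>i\<in>{1..n}. topcontinuous_at X (total (V i)) (\<lambda>z. f0 z i) x)"
proof -
  have mem: "f0 z i \<in> topspace (total (V i))" if "i \<in> {1..n}" "z \<in> topspace X" for i z
    using PiE_mem[OF f0[OF that(2), unfolded carrier_sum_space] that(1)]
      carrier_summand_stalk[OF that] by simp
  have box: "f0 z \<in> (\<Pi>\<^sub>E i\<in>{1..n}. topspace (total (V i)))" if "z \<in> topspace X" for z
    using f0[OF that] mem[OF _ that] by (simp add: carrier_sum_space PiE_iff)
  then have ext: "f0 z \<in> extensional {1..n}" if "z \<in> topspace X" for z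
    using that by (simp add: PiE_iff)
  have ev: "\<forall>\<^sub>F z in atin X x. z \<in> topspace X"
    using x by (auto simp: eventually_atin)
  \<comment> \<open>Limits in a subspace and in a product both require the values to lie eventually
    in the respective set; this and \<open>ev_box\<close> provide that.\<close>
  have ev_carrier: "\<forall>\<^sub>F z in atin X x. z \<in> topspace X \<and> f0 z \<in> carrier (sum_space n V z)"
    using ev by (rule eventually_mono) (simp add: f0)
  have ev_box: "\<forall>\<^sub>F z in atin X x. f0 z \<in> (\<Pi>\<^sub>E i\<in>{1..n}. topspace (total (V i)))"
    using ev by (rule eventually_mono) (rule box)
  have "limitin X (\<lambda>z. z) x (atin X x)"
    using limitin_continuous_map[OF continuous_map_id x] by (simp add: id_def)
  then have "limitin (sum_topology K X n V) (\<lambda>z. (z, f0 z)) (x, f0 x) (atin X x) \<longleftrightarrow>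
    (\<forall>i\<in>{1..n}. limitin (total (V i)) (\<lambda>z. f0 z i) (f0 x i) (atin X x))"
    using x f0[OF x] ext[OF x] ev_carrier ev_box
    by (simp add: sum_topology_eq product_top_def limitin_subtopology limitin_pairwise
        limitin_componentwise o_def)
  then show ?thesis
    using x f0 mem by (auto simp: topcontinuous_at_atin topspace_sum_topology)
qed

end

section \<open>Continuity and boundedness of sections of the direct sum\<close>

theorem corollary1p3p7:
  fixes K :: "complex set"
    and X :: "'x topology"
    and n :: nat
    and V :: "nat \<Rightarrow> ('x, 'e, 'j) omega_bundle"
    and f :: "'x \<Rightarrow> 'x \<times> (nat \<Rightarrow> 'e)"
    and f0 :: "'x \<Rightarrow> nat \<Rightarrow> 'e"
  assumes K: "K = \<real> \<or> K = UNIV"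
    and omega: "\<And>i. i \<in> {1..n} \<Longrightarrow> bundle_of_omega_spaces K (V i)"
    and full: "\<And>i. i \<in> {1..n} \<Longrightarrow> full_bundle (V i)"
    and base: "\<And>i. i \<in> {1..n} \<Longrightarrow> base (V i) = X"
    and f: "f \<in> topspace X \<rightarrow> topspace (total (bundle_sum K X n V))"
    and f0: "f0 \<in> topspace X \<rightarrow> (\<Union>z\<in>topspace X. carrier (sum_space n V z))"
    and f_f0: "\<And>z. z \<in> topspace X \<Longrightarrow> f z = (z, f0 z)"
  shows
    "(\<forall>x\<in>topspace X.
        topcontinuous_at X (total (bundle_sum K X n V)) f x \<longleftrightarrow>
        (\<forall>i\<in>{1..n}.
           topcontinuous_at X (total (V i))
             (\<lambda>z. sum_Pr n V i (proj (bundle_sum K X n V) (f z)) (f0 z)) x)) \<and>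
     (f \<in> sections (bundle_sum K X n V) \<longleftrightarrow>
        (\<forall>i\<in>{1..n}. (\<lambda>z. sum_Pr n V i z (f0 z)) \<in> sections (V i)))"
proof -
  interpret full_bundle_family K X n V
    using K omega full base by unfold_locales
  let ?B = "bundle_sum K X n V"
  \<comment> \<open>The hypothesis on \<open>f0\<close> only places its values in the union of all
    stalks; that the stalk is the one over \<open>z\<close> follows from \<open>f z\<close> being a
    point of the total space.\<close>
  have mem: "f0 z \<in> carrier (sum_space n V z)" if "z \<in> topspace X" for z
    using funcset_mem[OF f that] f_f0[OF that] by (simp add: bundle_sum_def topspace_sum_topology)
  have Pr: "sum_Pr n V i z (f0 z) = f0 z i" if "z \<in> topspace X" for i z
    using mem[OF that] by (simp add: sum_Pr_def)
  have cont: "topcontinuous_at X (total ?B) f x \<longleftrightarrow>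
      (\<forall>i\<in>{1..n}. topcontinuous_at X (total (V i)) (\<lambda>z. f0 z i) x)" if "x \<in> topspace X" for x
    using topcontinuous_at_sum_iff[of f0, OF mem that] topcontinuous_at_cong[of X f "\<lambda>z. (z, f0 z)"] f_f0
    by (simp add: bundle_sum_def)
  have fst_cont: "\<forall>x\<in>topspace X. topcontinuous_at X (total ?B) f x \<longleftrightarrow>
      (\<forall>i\<in>{1..n}. topcontinuous_at X (total (V i))
        (\<lambda>z. sum_Pr n V i (proj ?B (f z)) (f0 z)) x)"
  proof
    fix x assume x: "x \<in> topspace X"
    have "topcontinuous_at X (total (V i)) (\<lambda>z. sum_Pr n V i (proj ?B (f z)) (f0 z)) x
      \<longleftrightarrow> topcontinuous_at X (total (V i)) (\<lambda>z. f0 z i) x" for i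
      by (rule topcontinuous_at_cong) (simp add: bundle_sum_def f_f0 Pr)
    then show "topcontinuous_at X (total ?B) f x \<longleftrightarrow> (\<forall>i\<in>{1..n}. topcontinuous_at X (total (V i))
        (\<lambda>z. sum_Pr n V i (proj ?B (f z)) (f0 z)) x)"
      using cont[OF x] by simp
  qed
  have contmap: "continuous_map X (total ?B) f \<longleftrightarrow>
      (\<forall>i\<in>{1..n}. continuous_map X (total (V i)) (\<lambda>z. sum_Pr n V i z (f0 z)))"
  proof -
    have "topcontinuous_at X (total (V i)) (\<lambda>z. sum_Pr n V i z (f0 z)) x
      \<longleftrightarrow> topcontinuous_at X (total (V i)) (\<lambda>z. f0 z i) x" for i x
      by (rule topcontinuous_at_cong) (simp add: Pr)
    then show ?thesis
      unfolding continuous_map_eq_topcontinuous_at using cont by auto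
  qed
  have semi: "seminorm ?B \<rho> (f z) = (\<Sum>i=1..n. seminorm (V i) (\<rho> i) (sum_Pr n V i z (f0 z)))"
    if "z \<in> topspace X" for \<rho> z
    using f_f0[OF that] by (simp add: bundle_sum_def sum_seminorm_def)
  have Pr_mem: "sum_Pr n V i z (f0 z) \<in> carrier (stalk (V i) z)" if "i \<in> {1..n}" "z \<in> topspace X" for i z
    using mem[OF that(2)] Pr[OF that(2)] that(1) by (auto simp: carrier_sum_space)
  have nonneg: "0 \<le> seminorm (V i) j (sum_Pr n V i z (f0 z))"
    if "i \<in> {1..n}" "j \<in> index (V i)" "z \<in> topspace X" for i j z
    using omega_space_bundle.seminorm_nonneg[OF summand'[OF that(1)], of z j] Pr_mem[of i z] that base
    by simp
  \<comment> \<open>A sum of nonnegative functions dominates each summand, and conversely bounds of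
    the summands add up to a bound of the sum.\<close>
  have bounded: "(\<forall>\<rho>\<in>index ?B. bdd_above ((\<lambda>z. seminorm ?B \<rho> (f z)) ` topspace X)) \<longleftrightarrow>
      (\<forall>i\<in>{1..n}. \<forall>j\<in>index (V i).
        bdd_above ((\<lambda>z. seminorm (V i) j (sum_Pr n V i z (f0 z))) ` topspace X))"
    (is "?L \<longleftrightarrow> ?R")
  proof
    assume L: ?L
    show ?R
    proof (intro ballI)
      fix i j assume i: "i \<in> {1..n}" and j: "j \<in> index (V i)"
      show "bdd_above ((\<lambda>z. seminorm (V i) j (sum_Pr n V i z (f0 z))) ` topspace X)"
      \<comment> \<open>Over an empty base the image is empty. Otherwise a point of the base ensures
        that every summand has a seminorm to choose.\<close>
      proof (cases "topspace X = {}")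
        case False
        then obtain x where x: "x \<in> topspace X" by blast
        have "\<exists>l. l \<in> index (V k)" if "k \<in> {1..n}" for k
          using omega_space_bundle.index_nonempty[OF summand'[OF that], of x] x base[OF that] by auto
        then obtain l where l: "\<And>k. k \<in> {1..n} \<Longrightarrow> l k \<in> index (V k)" by metis
        \<comment> \<open>A multi-index with the prescribed \<open>j\<close> in position
          \<open>i\<close> and arbitrary admissible entries elsewhere.\<close>
        define \<rho> where "\<rho> = restrict (l(i := j)) {1..n}"
        have \<rho>: "\<rho> \<in> index ?B" using l i j by (auto simp: \<rho>_def bundle_sum_def sum_index_def)
        obtain M where M: "\<And>z. z \<in> topspace X \<Longrightarrow> seminorm ?B \<rho> (f z) \<le> M"
          using bspec[OF L \<rho>] by (auto simp: bdd_above_def)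
        have "seminorm (V i) j (sum_Pr n V i z (f0 z)) \<le> M" if z: "z \<in> topspace X" for z
        proof -
          have "seminorm (V i) (\<rho> i) (sum_Pr n V i z (f0 z))
              \<le> (\<Sum>i=1..n. seminorm (V i) (\<rho> i) (sum_Pr n V i z (f0 z)))"
            using i nonneg z l j by (intro member_le_sum) (auto simp: \<rho>_def)
          then show ?thesis using M[OF z] semi[OF z, of \<rho>] i by (simp add: \<rho>_def)
        qed
        then show ?thesis by (rule bdd_aboveI2)
      qed simp
    qed
  next
    assume R: ?R
    show ?L
    proof
      fix \<rho> assume "\<rho> \<in> index ?B"
      then have "\<exists>M. \<forall>z\<in>topspace X. seminorm (V i) (\<rho> i) (sum_Pr n V i z (f0 z)) \<le> M"
        if "i \<in> {1..n}" for i
        using R that by (auto simp: bundle_sum_def sum_index_def bdd_above_def PiE_iff)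
      then obtain M where M: "\<And>i z. \<lbrakk>i \<in> {1..n}; z \<in> topspace X\<rbrakk>
          \<Longrightarrow> seminorm (V i) (\<rho> i) (sum_Pr n V i z (f0 z)) \<le> M i"
        by metis
      have "seminorm ?B \<rho> (f z) \<le> (\<Sum>i=1..n. M i)" if "z \<in> topspace X" for z
        unfolding semi[OF that] using M[OF _ that] by (intro sum_mono) auto
      then show "bdd_above ((\<lambda>z. seminorm ?B \<rho> (f z)) ` topspace X)" by (rule bdd_aboveI2)
    qed
  qed
  have stalk_mem: "f \<in> (\<Pi> z\<in>topspace X. carrier (stalk ?B z))"
    using mem f_f0 by (auto simp: bundle_sum_def sum_stalk_def)
  have baseB: "omega_bundle.base ?B = X" by (simp add: bundle_sum_def)
  \<comment> \<open>Stalk membership holds on both sides, so being a section reduces to continuity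
    and boundedness, which have been compared separately.\<close>
  have "f \<in> sections ?B \<longleftrightarrow> continuous_map X (total ?B) f \<and>
      (\<forall>\<rho>\<in>index ?B. bdd_above ((\<lambda>z. seminorm ?B \<rho> (f z)) ` topspace X))"
    using stalk_mem by (simp add: sections_on_def baseB)
  moreover have "(\<forall>i\<in>{1..n}. (\<lambda>z. sum_Pr n V i z (f0 z)) \<in> sections (V i)) \<longleftrightarrow>
      (\<forall>i\<in>{1..n}. continuous_map X (total (V i)) (\<lambda>z. sum_Pr n V i z (f0 z)) \<and>
        (\<forall>j\<in>index (V i).
          bdd_above ((\<lambda>z. seminorm (V i) j (sum_Pr n V i z (f0 z))) ` topspace X)))"
    by (intro ball_cong refl) (simp add: sections_on_def base Pr_mem)
  ultimately have "f \<in> sections ?B \<longleftrightarrow> (\<forall>i\<in>{1..n}. (\<lambda>z. sum_Pr n V i z (f0 z)) \<in> sections (V i))"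
    unfolding ball_conj_distrib contmap bounded by (simp only:)
  with fst_cont show ?thesis by (rule conjI)
qed

end
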